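(* Let $N\ge 3$ and $\alpha>2$, and put $2^*:=\frac{2N}{N-2}$. Then $C_{N,\alpha}>0$ if and only if $\alpha\ge 2^*$. More precisely, if $\alpha\ge 2^*$, then, with $p_\alpha:=\frac{N\alpha}{N+\alpha}$ (so that $2\le p_\alpha<N$), $$0<\kappa_{p_\alpha}\,\mathcal S_{p_\alpha}\le C_{N,\alpha}<+\infty .$$
   Context: $\mathbb Z^N$ is the integer lattice graph: $x\sim y$ iff $\sum_{i=1}^N|x^{(i)}-y^{(i)}|=1$. For $u:\mathbb Z^N\to\mathbb R$ and $x\sim y$ write $\nabla_{xy}u:=u(y)-u(x)$. $\ell^q(\mathbb Z^N)$ is the usual space with norm $\|u\|_{\ell^q}=(\sum_x|u(x)|^q)^{1/q}$. For $1\le p<N$ put $p^*:=\frac{Np}{N-p}$ and $\|u\|_{D^{1,p}(\mathbb Z^N)}:=\big(\frac12\sum_{x\in\mathbb Z^N}\sum_{y\sim x}|\nabla_{xy}u|^p\big)^{1/p}$. $D^{1,p}(\mathbb Z^N)$ is the completion of the finitely supported functions in this norm; by the discrete Sobolev inequality it is realized as the set of $u\in\ell^{p^*}(\mathbb Z^N)$ for which there are finitely supported $\varphi_k$ with $\|u-\varphi_k\|_{D^{1,p}}\to0$. $X:=\{u\in D^{1,2}(\mathbb Z^N): |\nabla_{xy}u|\le 1 \text{ for every } x\sim y\}$ and, for $u\in X$, $J(u):=\frac12\sum_{x\in\mathbb Z^N}\sum_{y\sim x}\big(1-\sqrt{1-|\nabla_{xy}u|^2}\big)$. $C_{N,\alpha}:=\inf_{u\in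 (X\cap\ell^\alpha(\mathbb Z^N))\setminus\{0\}} J(u)\Big/\Big(\sum_{x\in\mathbb Z^N}|u(x)|^\alpha\Big)^{\frac{N}{N+\alpha}}$. For $2\le p<N$, $\mathcal S_p:=\inf_{u\in D^{1,p}(\mathbb Z^N)\setminus\{0\}}\|u\|_{D^{1,p}(\mathbb Z^N)}^p/\|u\|_{\ell^{p^*}(\mathbb Z^N)}^p$. The discrete Sobolev inequality says that for $1\le p<N$ and $q\ge p^*$ there is a constant $\overline C_{N,p,q}$ with $\|u\|_{\ell^q}\le\overline C_{N,p,q}\|u\|_{D^{1,p}}$ for all $u\in D^{1,p}(\mathbb Z^N)$; in particular $\mathcal S_p>0$. For $p\ge2$, $\kappa_p:=\inf_{0<s\le1}\frac{1-\sqrt{1-s}}{s^{p/2}}$. *)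

theory Defs
  imports "HOL-Analysis.Analysis"
begin

text \<open>The lattice \<open>\<int>\<^sup>N\<close> is the type \<open>int ^ 'n\<close> with \<open>N = CARD('n)\<close>.  Constants that depend on
  \<open>N\<close> but not on a function on the lattice take an argument of type \<open>'n itself\<close>.\<close>

type_synonym 'n lattice = "int ^ 'n"

definition adj :: "'n::finite lattice \<Rightarrow> 'n lattice \<Rightarrow> bool" where
  "adj x y \<longleftrightarrow> (\<Sum>i\<in>UNIV. \<bar>x $ i - y $ i\<bar>) = 1"

lemma finite_adj: "finite {y. adj x y}"
proof -
  have "{y. adj x y} \<subseteq> (\<lambda>f. \<chi> i. f i) ` (\<Pi>\<^sub>E i\<in>UNIV. {x $ i - 1 .. x $ i + 1})"
  proof
    fix y assume "y \<in> {y. adj x y}"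
    then have s: "(\<Sum>i\<in>UNIV. \<bar>x $ i - y $ i\<bar>) = 1"
      by (simp add: adj_def)
    have "\<bar>x $ i - y $ i\<bar> \<le> 1" for i
      using member_le_sum[of i UNIV "\<lambda>i. \<bar>x $ i - y $ i\<bar>"] s by simp
    then have "y $ i \<in> {x $ i - 1 .. x $ i + 1}" for i
      by (smt (verit) atLeastAtMost_iff)
    then have "(\<lambda>i. y $ i) \<in> (\<Pi>\<^sub>E i\<in>UNIV. {x $ i - 1 .. x $ i + 1})"
      by (simp add: PiE_UNIV_domain)
    moreover have "y = (\<chi> i. y $ i)"
      by simp
    ultimately show "y \<in> (\<lambda>f. \<chi> i. f i) ` (\<Pi>\<^sub>E i\<in>UNIV. {x $ i - 1 .. x $ i + 1})"
      by blast
  qed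
  moreover have "finite (\<Pi>\<^sub>E i\<in>UNIV. {x $ i - 1 .. x $ i + 1})"
    by (intro finite_PiE) auto
  ultimately show ?thesis
    using finite_surj by blast
qed

definition grad :: "'n::finite lattice \<Rightarrow> 'n lattice \<Rightarrow> ('n lattice \<Rightarrow> real) \<Rightarrow> real" where
  "grad x y u = u y - u x"

definition lspace :: "real \<Rightarrow> ('n::finite lattice \<Rightarrow> real) set" where
  "lspace q = {u. (\<lambda>x. \<bar>u x\<bar> powr q) summable_on UNIV}"

definition lnorm :: "real \<Rightarrow> ('n::finite lattice \<Rightarrow> real) \<Rightarrow> real" where
  "lnorm q u = (\<Sum>\<^sub>\<infinity>x. \<bar>u x\<bar> powr q) powr (1 / q)"

definition sobolev_conj :: "'n::finite itself \<Rightarrow> real \<Rightarrow> real" where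
  "sobolev_conj _ p = real CARD('n) * p / (real CARD('n) - p)"

definition Dnorm_finite :: "real \<Rightarrow> ('n::finite lattice \<Rightarrow> real) \<Rightarrow> bool" where
  "Dnorm_finite p u \<longleftrightarrow> (\<lambda>x. \<Sum>y | adj x y. \<bar>grad x y u\<bar> powr p) summable_on UNIV"

definition Dnorm :: "real \<Rightarrow> ('n::finite lattice \<Rightarrow> real) \<Rightarrow> real" where
  "Dnorm p u = (1/2 * (\<Sum>\<^sub>\<infinity>x. \<Sum>y | adj x y. \<bar>grad x y u\<bar> powr p)) powr (1 / p)"

text \<open>The real-valued \<^const>\<open>Dnorm\<close> is \<open>0\<close> on functions whose energy diverges, so approximation
  in this norm has to be accompanied by finiteness of the energy of the differences.\<close>

definition Dspace :: "real \<Rightarrow> ('n::finite lattice \<Rightarrow> real) set" where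
  "Dspace p = {u \<in> lspace (sobolev_conj TYPE('n) p).
     \<exists>\<phi> :: nat \<Rightarrow> 'n lattice \<Rightarrow> real.
       (\<forall>k. finite {x. \<phi> k x \<noteq> 0}) \<and>
       (\<forall>k. Dnorm_finite p (\<lambda>x. u x - \<phi> k x)) \<and>
       (\<lambda>k. Dnorm p (\<lambda>x. u x - \<phi> k x)) \<longlonglongrightarrow> 0}"

definition Xset :: "('n::finite lattice \<Rightarrow> real) set" where
  "Xset = {u \<in> Dspace 2. \<forall>x y. adj x y \<longrightarrow> \<bar>grad x y u\<bar> \<le> 1}"

text \<open>On \<^const>\<open>Xset\<close> the sum below converges, because \<open>1 - sqrt (1 - t\<^sup>2) \<le> t\<^sup>2\<close> for
  \<open>\<bar>t\<bar> \<le> 1\<close>.\<close>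

definition J :: "('n::finite lattice \<Rightarrow> real) \<Rightarrow> real" where
  "J u = 1/2 * (\<Sum>\<^sub>\<infinity>x. \<Sum>y | adj x y. 1 - sqrt (1 - \<bar>grad x y u\<bar>\<^sup>2))"

text \<open>The infima are taken in \<^typ>\<open>ereal\<close>, where the infimum of the empty set is \<open>\<infinity>\<close>; thus
  finiteness of \<open>C_const\<close> is a genuine assertion.\<close>

definition C_const :: "'n::finite itself \<Rightarrow> real \<Rightarrow> ereal" where
  "C_const _ \<alpha> = (INF u \<in> (Xset \<inter> lspace \<alpha>) - {\<lambda>x :: 'n lattice. 0}.
     ereal (J u / (\<Sum>\<^sub>\<infinity>x. \<bar>u x\<bar> powr \<alpha>) powr (real CARD('n) / (real CARD('n) + \<alpha>))))"

definition S_const :: "'n::finite itself \<Rightarrow> real \<Rightarrow> ereal" where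
  "S_const _ p = (INF u \<in> Dspace p - {\<lambda>x :: 'n lattice. 0}.
     ereal (Dnorm p u powr p / lnorm (sobolev_conj TYPE('n) p) u powr p))"

definition kappa :: "real \<Rightarrow> ereal" where
  "kappa p = (INF s \<in> {0<..1}. ereal ((1 - sqrt (1 - s)) / s powr (p / 2)))"

end

theory Submission
  imports Defs
begin

text \<open>The exponent \<open>p\<^sub>\<alpha>\<close> is the one with \<open>p\<^sub>\<alpha>\<^sup>* = \<alpha>\<close>, and \<open>p\<^sub>\<alpha> \<ge> 2\<close> is equivalent to \<open>\<alpha> \<ge> 2\<^sup>*\<close>.
  In that case \<open>1 - sqrt (1 - t\<^sup>2) \<ge> \<kappa> \<bar>t\<bar>\<^sup>p\<close> bounds \<open>J\<close> below by the \<open>p\<^sub>\<alpha>\<close>-energy, which the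
  discrete Sobolev inequality compares with the \<open>\<ell>\<^sup>\<alpha>\<close> norm; \<open>\<ell>\<^sup>2 \<subseteq> \<ell>\<^sup>p\<close> makes the approximants of a
  function in \<open>D\<^sup>1\<^sup>,\<^sup>2\<close> work in \<open>D\<^sup>1\<^sup>,\<^sup>p\<close> as well.  If \<open>p\<^sub>\<alpha> < 2\<close>, the quotient of a small multiple
  \<open>t \<delta>\<^sub>0\<close> of a point mass is of order \<open>t\<close> to the power \<open>2 - p\<^sub>\<alpha>\<close> and hence tends to \<open>0\<close>.\<close>

section \<open>Hoelder's inequality for finite sums\<close>

text \<open>Jensen's inequality for \<open>exp\<close> at the points \<open>ln (x i)\<close>. A
  vanishing \<open>x i\<close> has no usable logarithm, but it makes the product zero.\<close>

lemma weighted_AM_GM: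
  fixes x w :: "'i \<Rightarrow> real"
  assumes I: "finite I" "I \<noteq> {}" and w: "\<And>i. i \<in> I \<Longrightarrow> 0 < w i" "sum w I = 1"
    and x: "\<And>i. i \<in> I \<Longrightarrow> 0 \<le> x i"
  shows "(\<Prod>i\<in>I. x i powr w i) \<le> (\<Sum>i\<in>I. w i * x i)"
proof (cases "\<exists>i\<in>I. x i = 0")
  case True
  then have "(\<Prod>i\<in>I. x i powr w i) = 0"
    using I by (auto simp: prod_zero_iff)
  also have "0 \<le> (\<Sum>i\<in>I. w i * x i)"
    using w x by (intro sum_nonneg mult_nonneg_nonneg) (auto intro: less_imp_le)
  finally show ?thesis .
next
  case False
  then have pos: "0 < x i" if "i \<in> I" for i
    using x[OF that] that by force
  have "(\<Prod>i\<in>I. x i powr w i) = (\<Prod>i\<in>I. exp (w i * ln (x i)))"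
    by (intro prod.cong) (auto simp: powr_def dest: pos)
  also have "\<dots> = exp (\<Sum>i\<in>I. w i *\<^sub>R ln (x i))"
    using I by (simp add: exp_sum)
  also have "\<dots> \<le> (\<Sum>i\<in>I. w i * exp (ln (x i)))"
    using I w by (intro convex_on_sum[OF _ _ exp_convex]) (auto intro: less_imp_le)
  also have "\<dots> = (\<Sum>i\<in>I. w i * x i)"
    by (intro sum.cong) (auto dest: pos)
  finally show ?thesis .
qed

text \<open>After each \<open>h i\<close> is divided by its total \<open>H i\<close>, the weighted
  AM-GM inequality applies at every \<open>z\<close>; summed over \<open>Z\<close>, every normalised
  function contributes its weight, and the weights add up to 1. If some total is zero, that
  \<open>h i\<close> vanishes on \<open>Z\<close> and so does the left side.\<close>

lemma Hoelder_sum_prod: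
  fixes h :: "'i \<Rightarrow> 'z \<Rightarrow> real"
  assumes I: "finite I" "I \<noteq> {}" and w: "\<And>i. i \<in> I \<Longrightarrow> 0 < w i" "sum w I = 1"
    and Z: "finite Z" and h: "\<And>i z. i \<in> I \<Longrightarrow> z \<in> Z \<Longrightarrow> 0 \<le> h i z"
  shows "(\<Sum>z\<in>Z. \<Prod>i\<in>I. h i z powr w i) \<le> (\<Prod>i\<in>I. (\<Sum>z\<in>Z. h i z) powr w i)"
proof (cases "\<exists>i\<in>I. (\<Sum>z\<in>Z. h i z) = 0")
  case True
  then obtain i where i: "i \<in> I" "\<And>z. z \<in> Z \<Longrightarrow> h i z = 0"
    using h Z by (auto simp: sum_nonneg_eq_0_iff)
  then have "(\<Prod>i\<in>I. h i z powr w i) = 0" if "z \<in> Z" for z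
    using I that by (auto simp: prod_zero_iff)
  then have "(\<Sum>z\<in>Z. \<Prod>i\<in>I. h i z powr w i) = 0"
    by simp
  then show ?thesis
    by (simp add: prod_nonneg)
next
  case False
  define H where "H i = (\<Sum>z\<in>Z. h i z)" for i
  have H: "0 < H i" if "i \<in> I" for i
    using False that h unfolding H_def by (metis less_eq_real_def sum_nonneg)
  have "(\<Sum>z\<in>Z. \<Prod>i\<in>I. h i z powr w i)
      = (\<Sum>z\<in>Z. (\<Prod>i\<in>I. H i powr w i) * (\<Prod>i\<in>I. (h i z / H i) powr w i))"
    unfolding prod.distrib[symmetric]
    using H h by (intro sum.cong prod.cong) (auto simp: powr_divide less_imp_le, metis less_irrefl)
  also have "\<dots> \<le> (\<Sum>z\<in>Z. (\<Prod>i\<in>I. H i powr w i) * (\<Sum>i\<in>I. w i * (h i z / H i)))"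
    using H h I w by (intro sum_mono mult_left_mono weighted_AM_GM prod_nonneg)
      (auto intro: less_imp_le divide_nonneg_pos)
  also have "\<dots> = (\<Prod>i\<in>I. H i powr w i) * (\<Sum>i\<in>I. w i * (H i / H i))"
    unfolding sum_distrib_left[symmetric] H_def
    by (subst sum.swap) (auto simp: sum_distrib_left[symmetric] sum_divide_distrib[symmetric]
        intro!: sum.cong)
  also have "(\<Sum>i\<in>I. w i * (H i / H i)) = (\<Sum>i\<in>I. w i)"
    using H by (intro sum.cong) (auto, metis less_irrefl)
  finally show ?thesis
    using w by (simp add: H_def)
qed

text \<open>The two-factor case, with \<open>bool\<close> as index set and weights
  \<open>(p - 1) / p\<close> and \<open>1 / p\<close>.\<close>

lemma Hoelder_sum:
  fixes f g :: "'z \<Rightarrow> real"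
  assumes Z: "finite Z" and p: "1 < p"
    and fg: "\<And>z. z \<in> Z \<Longrightarrow> 0 \<le> f z" "\<And>z. z \<in> Z \<Longrightarrow> 0 \<le> g z"
  shows "(\<Sum>z\<in>Z. f z * g z)
    \<le> (\<Sum>z\<in>Z. f z powr (p / (p - 1))) powr ((p - 1) / p) * (\<Sum>z\<in>Z. g z powr p) powr (1 / p)"
proof -
  define h where "h b z = (if b then f z powr (p / (p - 1)) else g z powr p)" for b z
  define w where "w b = (if b then (p - 1) / p else 1 / p)" for b
  have "(\<Sum>z\<in>Z. f z * g z) = (\<Sum>z\<in>Z. \<Prod>b\<in>UNIV. h b z powr w b)"
    using p fg by (intro sum.cong) (auto simp: UNIV_bool h_def w_def powr_powr)
  also have "\<dots> \<le> (\<Prod>b\<in>UNIV. (\<Sum>z\<in>Z. h b z) powr w b)"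
    using p Z by (intro Hoelder_sum_prod) (auto simp: h_def w_def UNIV_bool field_simps)
  finally show ?thesis
    by (simp add: UNIV_bool h_def w_def mult.commute)
qed

section \<open>The Gagliardo-Nirenberg inequality on a box\<close>

definition box_set :: "int \<Rightarrow> 'n::finite lattice set" where
  "box_set M = {z. \<forall>i. \<bar>z $ i\<bar> \<le> M}"

lemma finite_box_set: "finite (box_set M :: 'n::finite lattice set)"
proof -
  have "box_set M \<subseteq> (\<lambda>f. \<chi> i. f i) ` (\<Pi>\<^sub>E i\<in>(UNIV::'n set). {-M..M})"
  proof
    fix z :: "'n lattice" assume "z \<in> box_set M"
    then have "(\<lambda>i. z $ i) \<in> (\<Pi>\<^sub>E i\<in>UNIV. {-M..M})"
      by (auto simp: box_set_def PiE_UNIV_domain abs_le_iff) (metis minus_le_iff)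
    moreover have "z = (\<chi> i. z $ i)"
      by simp
    ultimately show "z \<in> (\<lambda>f. \<chi> i. f i) ` (\<Pi>\<^sub>E i\<in>(UNIV::'n set). {-M..M})"
      by blast
  qed
  then show ?thesis
    by (rule finite_subset) (intro finite_imageI finite_PiE, auto)
qed

text \<open>\<open>S\<close> is the set of free coordinates. Partial sums thus stay functions on the
  full lattice that ignore the coordinates in \<open>S\<close>, and no lattice of lower dimension
  has to be introduced.\<close>

definition slice :: "int \<Rightarrow> 'n set \<Rightarrow> 'n::finite lattice \<Rightarrow> 'n lattice set" where
  "slice M S x = {z \<in> box_set M. \<forall>i. i \<notin> S \<longrightarrow> z $ i = x $ i}"

definition slice_sum :: "int \<Rightarrow> 'n set \<Rightarrow> ('n::finite lattice \<Rightarrow> real) \<Rightarrow> 'n lattice \<Rightarrow> real" where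
  "slice_sum M S f x = sum f (slice M S x)"

lemma finite_slice: "finite (slice M S x)"
  by (rule finite_subset[OF _ finite_box_set]) (auto simp: slice_def)

lemma slice_sum_empty: "x \<in> box_set M \<Longrightarrow> slice_sum M {} f x = f x"
proof -
  assume "x \<in> box_set M"
  then have "slice M {} x = {x}"
    by (auto simp: slice_def vec_eq_iff)
  then show ?thesis by (simp add: slice_sum_def)
qed

lemma slice_sum_UNIV: "slice_sum M UNIV f x = sum f (box_set M)"
  by (simp add: slice_sum_def slice_def)

lemma slice_sum_nonneg: "(\<And>z. z \<in> box_set M \<Longrightarrow> 0 \<le> f z) \<Longrightarrow> 0 \<le> slice_sum M S f x"
  unfolding slice_sum_def by (rule sum_nonneg) (auto simp: slice_def)

lemma slice_sum_cong: "(\<And>i. i \<notin> S \<Longrightarrow> x $ i = y $ i) \<Longrightarrow> slice_sum M S f x = slice_sum M S f y"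
  unfolding slice_sum_def by (rule arg_cong[where f = "sum f"]) (auto simp: slice_def)

text \<open>Fubini's theorem: as \<open>j\<close> is not in \<open>S\<close>, the slices through
  distinct points of a line in direction \<open>j\<close> are disjoint, and together they fill the
  larger slice.\<close>

lemma slice_sum_insert:
  assumes "j \<notin> S" and x: "x \<in> box_set M"
  shows "slice_sum M {j} (slice_sum M S f) x = slice_sum M (insert j S) f x"
proof -
  have "slice_sum M {j} (slice_sum M S f) x = sum f (\<Union>z\<in>slice M {j} x. slice M S z)"
    unfolding slice_sum_def
  proof (rule sum.UNION_disjoint[symmetric])
    show "\<forall>z\<in>slice M {j} x. \<forall>z'\<in>slice M {j} x. z \<noteq> z' \<longrightarrow> slice M S z \<inter> slice M S z' = {}"
    proof (intro ballI impI)
      fix z z' assume z: "z \<in> slice M {j} x" "z' \<in> slice M {j} x" "z \<noteq> z'"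
      then obtain k where "z $ k \<noteq> z' $ k"
        by (auto simp: vec_eq_iff)
      moreover from this z have "k = j"
        by (force simp: slice_def)
      ultimately show "slice M S z \<inter> slice M S z' = {}"
        using assms by (auto simp: slice_def)
    qed
  qed (auto simp: finite_slice)
  also have "(\<Union>z\<in>slice M {j} x. slice M S z) = slice M (insert j S) x"
  proof (intro equalityI subsetI)
    fix v assume v: "v \<in> slice M (insert j S) x"
    \<comment> \<open>The point of the line through \<open>x\<close> whose slice contains
      \<open>v\<close>; it lies in the box because both \<open>x\<close> and \<open>v\<close>
      do.\<close>
    define z where "z = (\<chi> k. if k = j then v $ j else x $ k)"
    have "z \<in> slice M {j} x" "v \<in> slice M S z"
      using v x by (auto simp: z_def slice_def box_set_def)
    then show "v \<in> (\<Union>z\<in>slice M {j} x. slice M S z)"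
      by blast
  qed (auto simp: slice_def)
  finally show ?thesis by (simp add: slice_sum_def)
qed

text \<open>The proof sums out one coordinate \<open>j\<close> at a time: the factor belonging to \<open>j\<close> is then constant
  along the line of summation, and Hoelder's inequality applies to the other \<open>N - 1\<close> factors.\<close>

lemma gagliardo_nirenberg_box:
  fixes f :: "'n::finite lattice \<Rightarrow> real" and g :: "'n \<Rightarrow> 'n lattice \<Rightarrow> real"
  defines "N \<equiv> real CARD('n)"
  assumes N: "CARD('n) \<ge> 2"
    and f: "\<And>x. x \<in> box_set M \<Longrightarrow> 0 \<le> f x"
    and g: "\<And>i x. x \<in> box_set M \<Longrightarrow> 0 \<le> g i x"
    and fg: "\<And>i x. x \<in> box_set M \<Longrightarrow> f x \<le> slice_sum M {i} (g i) x"
  shows "(\<Sum>x\<in>box_set M. f x powr (N / (N - 1)))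
    \<le> (\<Prod>i\<in>UNIV. (\<Sum>x\<in>box_set M. g i x) powr (1 / (N - 1)))"
proof -
  have N1: "N - 1 > 0" using N by (simp add: N_def)
  define F where "F x = f x powr (N / (N - 1))" for x
  \<comment> \<open>Direction \<open>i\<close> is always summed out in the factor \<open>i\<close>.
    So \<open>G {} i\<close> is the line sum from the hypothesis \<open>fg\<close>,
    \<open>G UNIV i\<close> is the full sum, and \<open>G S j\<close> agrees with
    \<open>G (insert j S) j\<close>.\<close>
  define G where "G S i x = slice_sum M (insert i S) (g i) x" for S i x
  have G0: "0 \<le> G S i x" for S i x
    unfolding G_def by (rule slice_sum_nonneg) (rule g)
  have "\<forall>x\<in>box_set M. slice_sum M S F x \<le> (\<Prod>i\<in>UNIV. G S i x powr (1 / (N - 1)))" for S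
    using finite[of S]
  proof (induction S rule: finite_induct)
    case empty
    show ?case
    proof
      fix x :: "'n lattice" assume x: "x \<in> box_set M"
      \<comment> \<open>The exponent is split into one share \<open>1 / (N - 1)\<close> for each of
        the \<open>N\<close> directions.\<close>
      have "F x = (\<Prod>i\<in>(UNIV::'n set). f x powr (1 / (N - 1)))"
        using N1 f[OF x] by (cases "f x = 0") (auto simp: F_def N_def powr_realpow[symmetric] powr_powr)
      also have "\<dots> \<le> (\<Prod>i\<in>UNIV. G {} i x powr (1 / (N - 1)))"
        using x N1 f fg by (intro prod_mono) (auto simp: G_def intro!: powr_mono2)
      finally show "slice_sum M {} F x \<le> (\<Prod>i\<in>UNIV. G {} i x powr (1 / (N - 1)))"
        using x by (simp add: slice_sum_empty)
    qed
  next
    case (insert j S)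
    show ?case
    proof
      fix x :: "'n lattice" assume x: "x \<in> box_set M"
      have Gj: "G S j z = G S j x" if "z \<in> slice M {j} x" for z
        unfolding G_def using that by (intro slice_sum_cong) (auto simp: slice_def)
      have GI: "slice_sum M {j} (G S i) x = G (insert j S) i x" if "i \<noteq> j" for i
        unfolding G_def using that insert.hyps slice_sum_insert[OF _ x, of j "insert i S" "g i"]
        by (simp add: insert_commute)
      \<comment> \<open>Hence the weights \<open>1 / (N - 1)\<close> of the remaining directions add
        up to 1, as Hoelder's inequality requires.\<close>
      have card: "real (card (UNIV - {j})) = N - 1"
        by (simp add: card_Diff_subset N_def of_nat_diff)
      have ne: "UNIV - {j} \<noteq> {}"
        using card N1 by force
      have "slice_sum M (insert j S) F x = (\<Sum>z\<in>slice M {j} x. slice_sum M S F z)"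
        using slice_sum_insert[OF insert.hyps(2) x, of F] by (simp add: slice_sum_def)
      also have "\<dots> \<le> (\<Sum>z\<in>slice M {j} x. \<Prod>i\<in>UNIV. G S i z powr (1 / (N - 1)))"
        using insert.IH by (intro sum_mono) (auto simp: slice_def)
      also have "\<dots> = (\<Sum>z\<in>slice M {j} x. G S j x powr (1 / (N - 1))
          * (\<Prod>i\<in>UNIV - {j}. G S i z powr (1 / (N - 1))))"
        using Gj by (intro sum.cong refl) (subst prod.remove[where x = j], auto)
      also have "\<dots> = G S j x powr (1 / (N - 1))
          * (\<Sum>z\<in>slice M {j} x. \<Prod>i\<in>UNIV - {j}. G S i z powr (1 / (N - 1)))"
        by (simp add: sum_distrib_left)
      also have "\<dots> \<le> G S j x powr (1 / (N - 1))
          * (\<Prod>i\<in>UNIV - {j}. (\<Sum>z\<in>slice M {j} x. G S i z) powr (1 / (N - 1)))"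
        using N1 card ne G0 by (intro mult_left_mono Hoelder_sum_prod) (auto simp: finite_slice)
      also have "\<dots> = G S j x powr (1 / (N - 1))
          * (\<Prod>i\<in>UNIV - {j}. G (insert j S) i x powr (1 / (N - 1)))"
        using GI by (intro arg_cong2[where f = "(*)"] prod.cong refl) (auto simp: slice_sum_def)
      also have "\<dots> = (\<Prod>i\<in>UNIV. G (insert j S) i x powr (1 / (N - 1)))"
        by (subst (2) prod.remove[where x = j]) (auto simp: G_def)
      finally show "slice_sum M (insert j S) F x \<le> (\<Prod>i\<in>UNIV. G (insert j S) i x powr (1 / (N - 1)))" .
    qed
  qed
  then have summed: "\<forall>x\<in>box_set M. slice_sum M UNIV F x \<le> (\<Prod>i\<in>UNIV. G UNIV i x powr (1 / (N - 1)))" .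
  show ?thesis
  proof (cases "box_set M = ({} :: 'n lattice set)")
    case True
    then show ?thesis by (simp add: prod_nonneg)
  next
    case False
    then obtain x :: "'n lattice" where "x \<in> box_set M" by blast
    with summed
    show ?thesis by (auto simp: slice_sum_UNIV G_def F_def)
  qed
qed

section \<open>The discrete Sobolev inequality\<close>

text \<open>The mean value theorem, with the derivative bounded by its value at the larger endpoint.
  Adding the power at the other endpoint makes the bound symmetric, so that it applies without
  knowing which value is larger. The endpoint 0, where the derivative rule for \<open>powr\<close>
  fails, is treated directly.\<close>

lemma powr_diff_le:
  fixes a b \<gamma> :: real
  assumes "0 \<le> a" "0 \<le> b" "1 \<le> \<gamma>"
  shows "\<bar>b powr \<gamma> - a powr \<gamma>\<bar> \<le> \<gamma> * (b powr (\<gamma> - 1) + a powr (\<gamma> - 1)) * \<bar>b - a\<bar>"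
proof -
  have ordered: "y powr \<gamma> - x powr \<gamma> \<le> \<gamma> * y powr (\<gamma> - 1) * (y - x)" if "0 \<le> x" "x < y" for x y
  proof (cases "x = 0")
    case True
    have "y powr \<gamma> = 1 * (y powr (\<gamma> - 1) * y)"
      using that by (simp add: powr_mult_base mult.commute)
    also have "\<dots> \<le> \<gamma> * (y powr (\<gamma> - 1) * y)"
      using that assms by (intro mult_right_mono) auto
    finally show ?thesis
      using True by (simp add: mult.assoc)
  next
    case False
    then have "\<exists>z>x. z < y \<and> y powr \<gamma> - x powr \<gamma> = (y - x) * (\<gamma> * z powr (\<gamma> - 1))"
      using that by (intro MVT2) (auto intro!: derivative_eq_intros)
    then obtain z where z: "x < z" "z < y" "y powr \<gamma> - x powr \<gamma> = (y - x) * (\<gamma> * z powr (\<gamma> - 1))"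
      by blast
    then have "z powr (\<gamma> - 1) \<le> y powr (\<gamma> - 1)"
      using that assms by (intro powr_mono2) auto
    then have "(y - x) * (\<gamma> * z powr (\<gamma> - 1)) \<le> (y - x) * (\<gamma> * y powr (\<gamma> - 1))"
      using that assms by (intro mult_left_mono) auto
    then show ?thesis
      using z by (simp add: mult_ac)
  qed
  have main: "\<bar>y powr \<gamma> - x powr \<gamma>\<bar> \<le> \<gamma> * (y powr (\<gamma> - 1) + x powr (\<gamma> - 1)) * \<bar>y - x\<bar>"
    if "0 \<le> x" "x < y" for x y
  proof -
    have "x powr \<gamma> \<le> y powr \<gamma>"
      using that assms by (intro powr_mono2) auto
    then have "\<bar>y powr \<gamma> - x powr \<gamma>\<bar> \<le> \<gamma> * y powr (\<gamma> - 1) * (y - x)"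
      using ordered[OF that] by simp
    also have "\<dots> \<le> \<gamma> * (y powr (\<gamma> - 1) + x powr (\<gamma> - 1)) * (y - x)"
      using that assms by (intro mult_right_mono mult_left_mono) auto
    finally show ?thesis
      using that by simp
  qed
  consider "a < b" | "a = b" | "b < a" by linarith
  then show ?thesis
    using main[of a b] main[of b a] assms
    by cases (auto simp: abs_minus_commute add.commute)
qed

text \<open>Telescoping along the line in direction \<open>i\<close>, from the face of the box up to
  \<open>x\<close>. The support leaves a margin of one layer, so \<open>f\<close> vanishes where the
  telescoping starts.\<close>

lemma le_slice_sum_diff:
  fixes f :: "'n::finite lattice \<Rightarrow> real"
  assumes supp: "{x. f x \<noteq> 0} \<subseteq> box_set (M - 1)" and x: "x \<in> box_set M"
  shows "f x \<le> slice_sum M {i} (\<lambda>z. \<bar>f (z + axis i 1) - f z\<bar>) x"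
proof -
  \<comment> \<open>The line through \<open>x\<close> in direction \<open>i\<close>, parametrised by
    its \<open>i\<close>-th coordinate.\<close>
  define L where "L t = (\<chi> k. if k = i then t else x $ k)" for t :: int
  have Li: "L t $ i = t" for t
    by (simp add: L_def)
  have Lx: "L (x $ i) = x"
    by (simp add: L_def vec_eq_iff)
  have Ls: "L t + axis i 1 = L (t + 1)" for t
    by (auto simp: L_def vec_eq_iff axis_def)
  have slice: "slice M {i} x = L ` {-M..M}"
  proof (intro equalityI subsetI)
    fix z assume z: "z \<in> slice M {i} x"
    then have "z = L (z $ i)" "\<bar>z $ i\<bar> \<le> M"
      by (auto simp: slice_def L_def vec_eq_iff box_set_def)
    then show "z \<in> L ` {-M..M}"
      by (intro image_eqI[of _ _ "z $ i"]) auto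
  next
    fix z assume "z \<in> L ` {-M..M}"
    then show "z \<in> slice M {i} x"
      using x by (auto simp: slice_def L_def box_set_def)
  qed
  have inj: "inj_on L {-M..M}"
    by (metis Li inj_onI)
  have sum: "slice_sum M {i} (\<lambda>z. \<bar>f (z + axis i 1) - f z\<bar>) x
      = (\<Sum>t\<in>{-M..M}. \<bar>f (L (t + 1)) - f (L t)\<bar>)"
    unfolding slice_sum_def slice by (simp add: sum.reindex[OF inj] Ls)
  have tel: "f (L (int n - M)) \<le> (\<Sum>t\<in>{-M..<int n - M}. \<bar>f (L (t + 1)) - f (L t)\<bar>)" for n
  proof (induction n)
    case 0
    have "L (- M) \<notin> box_set (M - 1)"
      using Li[of "- M"] by (auto simp: box_set_def intro!: exI[of _ i])
    then have "f (L (- M)) = 0" using supp by blast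
    then show ?case by simp
  next
    case (Suc n)
    have "{-M..<int (Suc n) - M} = insert (int n - M) {-M..<int n - M}"
      by auto
    moreover have "int (Suc n) - M = int n - M + 1" by simp
    ultimately show ?case using Suc by (simp only:) simp
  qed
  have xi: "- M \<le> x $ i" "x $ i \<le> M"
    using x by (auto simp: box_set_def abs_le_iff) (metis minus_le_iff)
  have "f x = f (L (int (nat (x $ i + M)) - M))"
    using xi by (simp add: Lx)
  also have "\<dots> \<le> (\<Sum>t\<in>{-M..<int (nat (x $ i + M)) - M}. \<bar>f (L (t + 1)) - f (L t)\<bar>)"
    by (rule tel)
  also have "\<dots> \<le> (\<Sum>t\<in>{-M..M}. \<bar>f (L (t + 1)) - f (L t)\<bar>)"
    using xi by (intro sum_mono2) auto
  finally show ?thesis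
    by (simp add: sum)
qed

lemma finite_subset_box_set:
  assumes "finite (A :: 'n::finite lattice set)"
  obtains M where "A \<subseteq> box_set M"
proof
  show "A \<subseteq> box_set (\<Sum>x\<in>A. \<Sum>i\<in>UNIV. \<bar>x $ i\<bar>)"
  proof
    fix x assume "x \<in> A"
    have "\<bar>x $ i\<bar> \<le> (\<Sum>x\<in>A. \<Sum>i\<in>UNIV. \<bar>x $ i\<bar>)" for i
    proof -
      have "\<bar>x $ i\<bar> \<le> (\<Sum>i\<in>UNIV. \<bar>x $ i\<bar>)"
        by (rule member_le_sum) auto
      also have "\<dots> \<le> (\<Sum>x\<in>A. \<Sum>i\<in>UNIV. \<bar>x $ i\<bar>)"
        using \<open>x \<in> A\<close> assms
        by (intro member_le_sum[of x A "\<lambda>x. \<Sum>i\<in>UNIV. \<bar>x $ i\<bar>"]) (auto intro: sum_nonneg)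
      finally show ?thesis .
    qed
    then show "x \<in> box_set (\<Sum>x\<in>A. \<Sum>i\<in>UNIV. \<bar>x $ i\<bar>)"
      by (simp add: box_set_def)
  qed
qed

text \<open>The Gagliardo-Nirenberg inequality is applied to
  \<open>\<bar>u\<bar> powr \<gamma>\<close>. The exponent \<open>\<gamma>\<close> is chosen so that
  the left side becomes the sum \<open>T\<close> of \<open>\<bar>u\<bar> powr q\<close> and
  Hoelder's inequality on the differences produces a power of the same \<open>T\<close>. Finite
  support makes \<open>T\<close> a finite number, so this power can be divided out.\<close>

lemma sobolev_finite_support:
  fixes u :: "'n::finite lattice \<Rightarrow> real" and p E :: real
  defines "N \<equiv> real CARD('n)"
  defines "q \<equiv> N * p / (N - p)" and "\<gamma> \<equiv> p * (N - 1) / (N - p)"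
  assumes p: "1 < p" "p < N"
    and fin: "finite {x. u x \<noteq> 0}"
    and E: "\<And>F. finite F \<Longrightarrow> (\<Sum>x\<in>F. \<Sum>i\<in>UNIV. \<bar>u (x + axis i 1) - u x\<bar> powr p) \<le> E"
  shows "(\<Sum>x | u x \<noteq> 0. \<bar>u x\<bar> powr q) powr (1 / q) \<le> 2 * \<gamma> * E powr (1 / p)"
proof -
  have N1: "N > 1" using p by simp
  have "CARD('n) \<ge> 2" using N1 by (simp add: N_def)
  have q0: "q > 0" using p N1 by (simp add: q_def)
  have \<gamma>1: "\<gamma> \<ge> 1"
  proof -
    have "N * 1 \<le> N * p" using p N1 by (intro mult_left_mono) auto
    then show ?thesis using p by (simp add: \<gamma>_def field_simps)
  qed
  have \<gamma>q: "(\<gamma> - 1) * (p / (p - 1)) = q"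
  proof -
    have "\<gamma> - 1 = N * (p - 1) / (N - p)"
      using p by (simp add: \<gamma>_def field_simps)
    then show ?thesis using p by (simp add: q_def)
  qed
  have \<gamma>N: "\<gamma> * (N / (N - 1)) = q"
    using p N1 by (simp add: \<gamma>_def q_def)
  \<comment> \<open>The exponent of \<open>T\<close> that survives the division at the end.\<close>
  have qq: "(N - 1) / N - (p - 1) / p = 1 / q"
    using p N1 by (simp add: q_def field_simps)
  obtain M' where "{x. u x \<noteq> 0} \<subseteq> box_set M'"
    using finite_subset_box_set[OF fin] by blast
  then obtain M where supp: "{x. u x \<noteq> 0} \<subseteq> box_set (M - 1)"
    by (metis add_diff_cancel_right')
  define B where "B = (box_set M :: 'n lattice set)"
  have finB: "finite B" by (simp add: B_def finite_box_set)
  have suppB: "{x. u x \<noteq> 0} \<subseteq> B"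
  proof -
    have "box_set (M - 1) \<subseteq> B"
      by (force simp: B_def box_set_def intro: less_imp_le)
    then show ?thesis using supp by blast
  qed
  define T where "T = (\<Sum>x | u x \<noteq> 0. \<bar>u x\<bar> powr q)"
  have T0: "0 \<le> T" by (simp add: T_def sum_nonneg)
  \<comment> \<open>Arbitrary finite sets are allowed because the box shifted by a unit vector is
    not contained in \<open>B\<close>.\<close>
  have T: "(\<Sum>x\<in>F. \<bar>u x\<bar> powr q) \<le> T" if "finite F" for F
  proof -
    have "(\<Sum>x\<in>F. \<bar>u x\<bar> powr q) = (\<Sum>x\<in>F \<inter> {x. u x \<noteq> 0}. \<bar>u x\<bar> powr q)"
      using that by (intro sum.mono_neutral_right) auto
    also have "\<dots> \<le> T"
      unfolding T_def using fin by (intro sum_mono2) auto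
    finally show ?thesis .
  qed
  have E0: "0 \<le> E" using E[of "{}"] by simp
  define f where "f x = \<bar>u x\<bar> powr \<gamma>" for x
  define g where "g i x = \<bar>f (x + axis i 1) - f x\<bar>" for i x
  define d where "d i x = \<bar>u (x + axis i 1) - u x\<bar>" for i x
  \<comment> \<open>A common bound for the sums of all \<open>g i\<close>; the factor 2 counts the
    two endpoints of an edge.\<close>
  define K where "K = 2 * \<gamma> * (T powr ((p - 1) / p) * E powr (1 / p))"
  have K0: "0 \<le> K" using \<gamma>1 by (simp add: K_def)
  have dE: "(\<Sum>x\<in>B. d i x powr p) powr (1 / p) \<le> E powr (1 / p)" for i
  proof -
    have "(\<Sum>x\<in>B. d i x powr p) \<le> (\<Sum>x\<in>B. \<Sum>i\<in>UNIV. d i x powr p)"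
      by (intro sum_mono member_le_sum) auto
    also have "\<dots> \<le> E" unfolding d_def by (rule E[OF finB])
    finally show ?thesis using p by (intro powr_mono2) (auto intro: sum_nonneg)
  qed
  \<comment> \<open>Used with \<open>\<tau>\<close> the identity and the unit shift, one for each
    endpoint term of \<open>powr_diff_le\<close>.\<close>
  have hoelder: "(\<Sum>x\<in>B. \<bar>u (\<tau> x)\<bar> powr (\<gamma> - 1) * d i x) \<le> T powr ((p - 1) / p) * E powr (1 / p)"
    if "inj_on \<tau> B" for \<tau> i
  proof -
    have "(\<Sum>x\<in>B. (\<bar>u (\<tau> x)\<bar> powr (\<gamma> - 1)) powr (p / (p - 1))) = (\<Sum>x\<in>\<tau> ` B. \<bar>u x\<bar> powr q)"
      unfolding sum.reindex[OF that] powr_powr \<gamma>q by simp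
    also have "\<dots> \<le> T"
      using finB by (intro T) auto
    finally have le: "(\<Sum>x\<in>B. (\<bar>u (\<tau> x)\<bar> powr (\<gamma> - 1)) powr (p / (p - 1))) \<le> T" .
    have "(\<Sum>x\<in>B. \<bar>u (\<tau> x)\<bar> powr (\<gamma> - 1) * d i x)
      \<le> (\<Sum>x\<in>B. (\<bar>u (\<tau> x)\<bar> powr (\<gamma> - 1)) powr (p / (p - 1))) powr ((p - 1) / p)
        * (\<Sum>x\<in>B. d i x powr p) powr (1 / p)"
      using p by (intro Hoelder_sum finB) (auto simp: d_def)
    also have "\<dots> \<le> T powr ((p - 1) / p) * E powr (1 / p)"
      using p by (intro mult_mono powr_mono2 le dE) (auto intro: sum_nonneg)
    finally show ?thesis .
  qed
  have gK: "(\<Sum>x\<in>B. g i x) \<le> K" for i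
  proof -
    have "(\<Sum>x\<in>B. g i x)
      \<le> (\<Sum>x\<in>B. \<gamma> * (\<bar>u (x + axis i 1)\<bar> powr (\<gamma> - 1) + \<bar>u x\<bar> powr (\<gamma> - 1)) * d i x)"
    proof (rule sum_mono)
      fix x
      have "g i x \<le> \<gamma> * (\<bar>u (x + axis i 1)\<bar> powr (\<gamma> - 1) + \<bar>u x\<bar> powr (\<gamma> - 1))
          * \<bar>\<bar>u (x + axis i 1)\<bar> - \<bar>u x\<bar>\<bar>"
        unfolding g_def f_def using \<gamma>1 by (intro powr_diff_le) auto
      also have "\<dots> \<le> \<gamma> * (\<bar>u (x + axis i 1)\<bar> powr (\<gamma> - 1) + \<bar>u x\<bar> powr (\<gamma> - 1)) * d i x"
        unfolding d_def using \<gamma>1 by (intro mult_left_mono) auto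
      finally show "g i x \<le> \<gamma> * (\<bar>u (x + axis i 1)\<bar> powr (\<gamma> - 1) + \<bar>u x\<bar> powr (\<gamma> - 1)) * d i x" .
    qed
    also have "\<dots> = \<gamma> * ((\<Sum>x\<in>B. \<bar>u (x + axis i 1)\<bar> powr (\<gamma> - 1) * d i x)
        + (\<Sum>x\<in>B. \<bar>u x\<bar> powr (\<gamma> - 1) * d i x))"
      by (simp add: sum_distrib_left sum.distrib[symmetric] algebra_simps)
    also have "\<dots> \<le> \<gamma> * (T powr ((p - 1) / p) * E powr (1 / p) + T powr ((p - 1) / p) * E powr (1 / p))"
      using \<gamma>1 hoelder[of "\<lambda>x. x + axis i 1" i] hoelder[of "\<lambda>x. x" i]
      by (intro mult_left_mono add_mono) auto
    finally show ?thesis by (simp add: K_def mult_ac)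
  qed
  have "T = (\<Sum>x\<in>B. \<bar>u x\<bar> powr q)"
    unfolding T_def using suppB finB by (intro sum.mono_neutral_left) auto
  also have "\<dots> = (\<Sum>x\<in>B. f x powr (N / (N - 1)))"
    unfolding f_def powr_powr \<gamma>N ..
  also have "\<dots> \<le> (\<Prod>i\<in>UNIV. (\<Sum>x\<in>B. g i x) powr (1 / (N - 1)))"
    unfolding B_def N_def
  proof (rule gagliardo_nirenberg_box)
    show "f x \<le> slice_sum M {i} (g i) x" if "x \<in> box_set M" for i x
      unfolding g_def using supp that by (intro le_slice_sum_diff) (auto simp: f_def)
  qed (use \<open>CARD('n) \<ge> 2\<close> in \<open>auto simp: f_def g_def\<close>)
  also have "\<dots> \<le> (\<Prod>i\<in>(UNIV :: 'n set). K powr (1 / (N - 1)))"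
    using gK N1 by (intro prod_mono conjI powr_mono2) (auto simp: g_def intro: sum_nonneg)
  also have "\<dots> = K powr (N / (N - 1))"
    using N1 K0 by (cases "K = 0") (auto simp: N_def powr_realpow[symmetric] powr_powr)
  finally have TK: "T \<le> K powr (N / (N - 1))" .
  show ?thesis
  \<comment> \<open>\<open>K\<close> itself contains a power of \<open>T\<close>, which is moved to
    the left side; this needs \<open>T\<close> to be nonzero.\<close>
  proof (cases "T = 0")
    case True
    then show ?thesis using \<gamma>1 by (simp add: T_def[symmetric])
  next
    case False
    have "T powr ((N - 1) / N) \<le> (K powr (N / (N - 1))) powr ((N - 1) / N)"
      using TK T0 N1 by (intro powr_mono2) auto
    also have "\<dots> = K"
      using N1 K0 by (simp add: powr_powr)
    finally have "T powr ((N - 1) / N) / T powr ((p - 1) / p) \<le> K / T powr ((p - 1) / p)"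
      by (rule divide_right_mono) simp
    then have "T powr ((N - 1) / N - (p - 1) / p) \<le> 2 * \<gamma> * E powr (1 / p)"
      using False by (simp add: powr_diff K_def)
    then show ?thesis by (simp only: qq T_def)
  qed
qed

section \<open>From finitely supported functions to summable ones\<close>

text \<open>Chebyshev's argument: each point of the set contributes at least
  \<open>\<epsilon> powr q\<close> to a convergent sum. It gives the soft thresholds finite
  support.\<close>

lemma finite_superlevel_lspace:
  assumes u: "u \<in> lspace q" and "0 < q" "0 < \<epsilon>"
  shows "finite {x. \<epsilon> < \<bar>u x\<bar>}"
proof (rule ccontr)
  assume inf: "infinite {x. \<epsilon> < \<bar>u x\<bar>}"
  define S where "S = (\<Sum>\<^sub>\<infinity>x. \<bar>u x\<bar> powr q)"
  obtain n :: nat where n: "S < real n * \<epsilon> powr q"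
    using assms reals_Archimedean3[of "\<epsilon> powr q"] by auto
  obtain F where F: "finite F" "card F = n" "F \<subseteq> {x. \<epsilon> < \<bar>u x\<bar>}"
    using infinite_arbitrarily_large[OF inf] by blast
  have "real n * \<epsilon> powr q = (\<Sum>x\<in>F. \<epsilon> powr q)"
    using F by simp
  also have "\<dots> \<le> (\<Sum>x\<in>F. \<bar>u x\<bar> powr q)"
    using F assms by (intro sum_mono powr_mono2) auto
  also have "\<dots> \<le> S"
    unfolding S_def using u F by (intro finite_sum_le_infsum) (auto simp: lspace_def)
  finally show False using n by simp
qed

text \<open>The soft threshold of \<open>u\<close> at height \<open>\<epsilon>\<close> is finitely supported and does not increase
  differences, so no density argument is needed.\<close>

lemma sobolev_lspace:
  fixes u :: "'n::finite lattice \<Rightarrow> real" and p E :: real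
  defines "N \<equiv> real CARD('n)"
  defines "q \<equiv> N * p / (N - p)" and "\<gamma> \<equiv> p * (N - 1) / (N - p)"
  assumes p: "1 < p" "p < N" and u: "u \<in> lspace q"
    and E: "\<And>F. finite F \<Longrightarrow> (\<Sum>x\<in>F. \<Sum>i\<in>UNIV. \<bar>u (x + axis i 1) - u x\<bar> powr p) \<le> E"
  shows "lnorm q u \<le> 2 * \<gamma> * E powr (1 / p)"
proof -
  define R where "R = 2 * \<gamma> * E powr (1 / p)"
  have q0: "q > 0" using p by (simp add: q_def)
  have R0: "R \<ge> 0" using p by (simp add: R_def \<gamma>_def)
  define v where "v \<epsilon> x = sgn (u x) * max 0 (\<bar>u x\<bar> - \<epsilon>)" for \<epsilon> x
  have v_abs: "\<bar>v \<epsilon> x\<bar> = max 0 (\<bar>u x\<bar> - \<epsilon>)" if "\<epsilon> > 0" for \<epsilon> x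
    using that by (auto simp: v_def abs_mult sgn_if)
  have trunc: "(\<Sum>x\<in>F. \<bar>v \<epsilon> x\<bar> powr q) \<le> R powr q" if F: "finite F" and \<epsilon>: "0 < \<epsilon>" for F \<epsilon>
  proof -
    have supp: "finite {x. v \<epsilon> x \<noteq> 0}"
      using finite_superlevel_lspace[OF u q0 \<epsilon>]
      by (rule finite_subset[rotated]) (auto simp: v_def)
    have "\<bar>v \<epsilon> y - v \<epsilon> x\<bar> \<le> \<bar>u y - u x\<bar>" for x y
      using \<epsilon> by (auto simp: v_def sgn_if max_def)
    then have "(\<Sum>x\<in>F. \<Sum>i\<in>UNIV. \<bar>v \<epsilon> (x + axis i 1) - v \<epsilon> x\<bar> powr p)
        \<le> (\<Sum>x\<in>F. \<Sum>i\<in>UNIV. \<bar>u (x + axis i 1) - u x\<bar> powr p)" for F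
      using p by (intro sum_mono powr_mono2) auto
    then have *: "(\<Sum>x | v \<epsilon> x \<noteq> 0. \<bar>v \<epsilon> x\<bar> powr q) powr (1 / q) \<le> R"
      unfolding R_def \<gamma>_def q_def N_def using p E
      by (intro sobolev_finite_support supp) (auto simp: N_def intro: order_trans)
    have "(\<Sum>x\<in>F. \<bar>v \<epsilon> x\<bar> powr q) = (\<Sum>x\<in>F \<inter> {x. v \<epsilon> x \<noteq> 0}. \<bar>v \<epsilon> x\<bar> powr q)"
      using F by (intro sum.mono_neutral_right) auto
    also have "\<dots> \<le> (\<Sum>x | v \<epsilon> x \<noteq> 0. \<bar>v \<epsilon> x\<bar> powr q)"
      using supp by (intro sum_mono2) auto
    also have "\<dots> = ((\<Sum>x | v \<epsilon> x \<noteq> 0. \<bar>v \<epsilon> x\<bar> powr q) powr (1 / q)) powr q"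
      using q0 by (simp add: powr_powr sum_nonneg)
    also have "\<dots> \<le> R powr q"
      using * q0 by (intro powr_mono2) auto
    finally show ?thesis .
  qed
  \<comment> \<open>The bound on the thresholds does not depend on \<open>\<epsilon>\<close>, so on
    a fixed finite set it survives the limit as \<open>\<epsilon>\<close> decreases to 0.\<close>
  have "(\<Sum>x\<in>F. \<bar>u x\<bar> powr q) \<le> R powr q" if F: "finite F" for F
  proof (rule tendsto_upperbound)
    show "((\<lambda>\<epsilon>. \<Sum>x\<in>F. (max 0 (\<bar>u x\<bar> - \<epsilon>)) powr q) \<longlongrightarrow> (\<Sum>x\<in>F. \<bar>u x\<bar> powr q)) (at_right 0)"
    proof (rule tendsto_sum)
      fix x
      have "((\<lambda>\<epsilon>. max 0 (\<bar>u x\<bar> - \<epsilon>)) \<longlongrightarrow> max 0 (\<bar>u x\<bar> - 0)) (at_right 0)"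
        by (intro tendsto_intros)
      then show "((\<lambda>\<epsilon>. (max 0 (\<bar>u x\<bar> - \<epsilon>)) powr q) \<longlongrightarrow> \<bar>u x\<bar> powr q) (at_right 0)"
        using q0 by (intro tendsto_powr' tendsto_const) auto
    qed
    show "\<forall>\<^sub>F \<epsilon> in at_right 0. (\<Sum>x\<in>F. (max 0 (\<bar>u x\<bar> - \<epsilon>)) powr q) \<le> R powr q"
      using trunc[OF F] by (auto simp: eventually_at_right_field v_abs intro!: exI[of _ 1])
  qed simp
  then have "(\<Sum>\<^sub>\<infinity>x. \<bar>u x\<bar> powr q) \<le> R powr q"
    using u by (intro infsum_le_finite_sums) (auto simp: lspace_def)
  then have "lnorm q u \<le> (R powr q) powr (1 / q)"
    unfolding lnorm_def using q0 by (intro powr_mono2 infsum_nonneg) auto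
  also have "\<dots> = R" using q0 R0 by (simp add: powr_powr)
  finally show ?thesis by (simp add: R_def)
qed

section \<open>Energies of lattice functions\<close>

lemma adj_commute: "adj x y \<longleftrightarrow> adj y x"
  by (simp add: adj_def abs_minus_commute)

lemma adj_add_axis: "adj x (x + axis i 1)"
proof -
  have "(\<Sum>k\<in>UNIV. \<bar>x $ k - (x + axis i 1) $ k\<bar>) = (\<Sum>k\<in>UNIV. if k = i then 1 else 0)"
    by (intro sum.cong) (auto simp: axis_def)
  then show ?thesis by (simp add: adj_def)
qed

text \<open>Links the forward differences of the Sobolev argument to sums over all neighbours: the
  forward neighbours are distinct, and the other neighbours only add nonnegative terms.\<close>

lemma sum_axis_le_sum_adj:
  fixes h :: "'n::finite lattice \<Rightarrow> real"
  assumes "\<And>y. 0 \<le> h y"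
  shows "(\<Sum>i\<in>UNIV. h (x + axis i 1)) \<le> (\<Sum>y | adj x y. h y)"
proof -
  have inj: "inj (\<lambda>i. x + axis i 1)"
    by (auto simp: inj_on_def axis_eq_axis)
  have "(\<Sum>i\<in>UNIV. h (x + axis i 1)) = (\<Sum>y\<in>range (\<lambda>i. x + axis i 1). h y)"
    by (simp add: sum.reindex[OF inj])
  also have "\<dots> \<le> (\<Sum>y | adj x y. h y)"
    using assms adj_add_axis by (intro sum_mono2 finite_adj) auto
  finally show ?thesis .
qed

text \<open>Every edge is counted from both ends, without the factor 1/2 of \<open>Dnorm\<close>. A
  divergent sum has the default value 0, so upper bounds by \<open>energy\<close> are accompanied by
  \<open>Dnorm_finite\<close>.\<close>

definition energy :: "real \<Rightarrow> ('n::finite lattice \<Rightarrow> real) \<Rightarrow> real" where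
  "energy p u = (\<Sum>\<^sub>\<infinity>x. \<Sum>y | adj x y. \<bar>grad x y u\<bar> powr p)"

lemma energy_nonneg: "0 \<le> energy p u"
  unfolding energy_def by (intro infsum_nonneg sum_nonneg) auto

lemma Dnorm_powr: "p > 0 \<Longrightarrow> Dnorm p u powr p = 1/2 * energy p u"
  using energy_nonneg[of p u] by (simp add: Dnorm_def energy_def powr_powr)

lemma Dnorm_eq_energy: "Dnorm p u = (1/2 * energy p u) powr (1 / p)"
  by (simp add: Dnorm_def energy_def)

lemma sum_le_energy:
  assumes "Dnorm_finite p u" "finite F"
  shows "(\<Sum>x\<in>F. \<Sum>y | adj x y. \<bar>grad x y u\<bar> powr p) \<le> energy p u"
  unfolding energy_def using assms
  by (intro finite_sum_le_infsum) (auto simp: Dnorm_finite_def intro: sum_nonneg)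

text \<open>Only points of the support and their neighbours carry a nonzero gradient term.\<close>

lemma Dnorm_finite_finite_support:
  fixes u :: "'n::finite lattice \<Rightarrow> real"
  assumes fin: "finite {x. u x \<noteq> 0}"
  shows "Dnorm_finite p u"
  unfolding Dnorm_finite_def
proof (rule finite_nonzero_values_imp_summable_on)
  have "{x. (\<Sum>y | adj x y. \<bar>grad x y u\<bar> powr p) \<noteq> 0}
      \<subseteq> {x. u x \<noteq> 0} \<union> (\<Union>y\<in>{x. u x \<noteq> 0}. {x. adj y x})"
  proof
    fix x assume "x \<in> {x. (\<Sum>y | adj x y. \<bar>grad x y u\<bar> powr p) \<noteq> 0}"
    then obtain y where "adj x y" "\<bar>grad x y u\<bar> powr p \<noteq> 0"
      by (auto elim: sum.not_neutral_contains_not_neutral)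
    then have "adj y x" "u x \<noteq> 0 \<or> u y \<noteq> 0"
      by (auto simp: grad_def adj_commute)
    then show "x \<in> {x. u x \<noteq> 0} \<union> (\<Union>y\<in>{x. u x \<noteq> 0}. {x. adj y x})"
      by auto
  qed
  then show "finite {x \<in> UNIV. (\<Sum>y | adj x y. \<bar>grad x y u\<bar> powr p) \<noteq> 0}"
    using fin finite_adj by (auto elim!: finite_subset)
qed

text \<open>Bounding the sum by twice the maximum covers every \<open>p \<ge> 0\<close>. The crude
  constant is good enough because only summability is drawn from it.\<close>

lemma abs_add_powr_le:
  fixes a b p :: real
  assumes "p \<ge> 0"
  shows "\<bar>a + b\<bar> powr p \<le> 2 powr p * (\<bar>a\<bar> powr p + \<bar>b\<bar> powr p)"
proof -
  have "\<bar>a + b\<bar> powr p \<le> (2 * max \<bar>a\<bar> \<bar>b\<bar>) powr p"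
    using assms by (intro powr_mono2) auto
  also have "\<dots> = 2 powr p * (max \<bar>a\<bar> \<bar>b\<bar>) powr p"
    by (simp add: powr_mult)
  also have "\<dots> \<le> 2 powr p * (\<bar>a\<bar> powr p + \<bar>b\<bar> powr p)"
    by (intro mult_left_mono) (auto simp: max_def)
  finally show ?thesis .
qed

lemma Dnorm_finite_add:
  assumes "p \<ge> 0" "Dnorm_finite p u" "Dnorm_finite p v"
  shows "Dnorm_finite p (\<lambda>x. u x + v x)"
  unfolding Dnorm_finite_def
proof (rule summable_on_comparison_test)
  show "(\<lambda>x. 2 powr p * ((\<Sum>y | adj x y. \<bar>grad x y u\<bar> powr p) + (\<Sum>y | adj x y. \<bar>grad x y v\<bar> powr p)))
      summable_on UNIV"
    using assms unfolding Dnorm_finite_def by (intro summable_on_cmult_right summable_on_add)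
  fix x
  have "(\<Sum>y | adj x y. \<bar>grad x y (\<lambda>x. u x + v x)\<bar> powr p)
      \<le> (\<Sum>y | adj x y. 2 powr p * (\<bar>grad x y u\<bar> powr p + \<bar>grad x y v\<bar> powr p))"
  proof (rule sum_mono)
    fix y
    have "grad x y (\<lambda>x. u x + v x) = grad x y u + grad x y v"
      by (simp add: grad_def)
    then show "\<bar>grad x y (\<lambda>x. u x + v x)\<bar> powr p
        \<le> 2 powr p * (\<bar>grad x y u\<bar> powr p + \<bar>grad x y v\<bar> powr p)"
      using abs_add_powr_le[OF assms(1)] by simp
  qed
  then show "(\<Sum>y | adj x y. \<bar>grad x y (\<lambda>x. u x + v x)\<bar> powr p)
      \<le> 2 powr p * ((\<Sum>y | adj x y. \<bar>grad x y u\<bar> powr p) + (\<Sum>y | adj x y. \<bar>grad x y v\<bar> powr p))"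
    by (simp add: sum_distrib_left sum.distrib distrib_left)
qed (simp add: sum_nonneg)

text \<open>A single approximant is enough: \<open>u\<close> is the sum of
  \<open>u - \<phi>\<close>, of finite energy, and the finitely supported
  \<open>\<phi>\<close>.\<close>

lemma Dspace_Dnorm_finite:
  assumes "p \<ge> 0" "u \<in> Dspace p"
  shows "Dnorm_finite p u"
proof -
  obtain \<phi> where "finite {x. \<phi> x \<noteq> 0}" "Dnorm_finite p (\<lambda>x. u x - \<phi> x)"
    using assms by (auto simp: Dspace_def)
  then have "Dnorm_finite p (\<lambda>x. (u x - \<phi> x) + \<phi> x)"
    using assms by (intro Dnorm_finite_add[OF _ _ Dnorm_finite_finite_support])
  then show ?thesis by simp
qed

lemma Dspace_finite_support:
  fixes u :: "'n::finite lattice \<Rightarrow> real"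
  assumes fin: "finite {x. u x \<noteq> 0}"
  shows "u \<in> Dspace p"
  unfolding Dspace_def
proof (intro CollectI conjI exI[of _ "\<lambda>_. u"] allI)
  have "finite {x \<in> UNIV. \<bar>u x\<bar> powr sobolev_conj TYPE('n) p \<noteq> 0}"
    using fin by simp
  then show "u \<in> lspace (sobolev_conj TYPE('n) p)"
    unfolding lspace_def by (blast intro: finite_nonzero_values_imp_summable_on)
qed (use fin in \<open>auto simp: Dnorm_def grad_def intro: Dnorm_finite_finite_support\<close>)

lemma lspace_infsum_pos:
  assumes "u \<in> lspace q" "u \<noteq> (\<lambda>x. 0)"
  shows "0 < (\<Sum>\<^sub>\<infinity>x. \<bar>u x\<bar> powr q)"
proof -
  obtain x where x: "u x \<noteq> 0"
    using assms by auto
  then have "0 < (\<Sum>x\<in>{x}. \<bar>u x\<bar> powr q)"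
    by simp
  also have "\<dots> \<le> (\<Sum>\<^sub>\<infinity>x. \<bar>u x\<bar> powr q)"
    using assms by (intro finite_sum_le_infsum) (auto simp: lspace_def)
  finally show ?thesis .
qed

text \<open>The factor \<open>2 powr (1 / p)\<close> undoes the 1/2 inside
  \<open>Dnorm\<close>.\<close>

lemma sobolev_Dspace:
  fixes u :: "'n::finite lattice \<Rightarrow> real" and p :: real
  defines "N \<equiv> real CARD('n)"
  assumes p: "1 < p" "p < N" and u: "u \<in> Dspace p"
  shows "lnorm (sobolev_conj TYPE('n) p) u
    \<le> 2 * (p * (N - 1) / (N - p)) * 2 powr (1 / p) * Dnorm p u"
proof -
  have fin: "Dnorm_finite p u"
    using p u by (intro Dspace_Dnorm_finite) auto
  have "lnorm (sobolev_conj TYPE('n) p) u \<le> 2 * (p * (N - 1) / (N - p)) * energy p u powr (1 / p)"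
    unfolding sobolev_conj_def N_def
  proof (rule sobolev_lspace)
    show "u \<in> lspace (real CARD('n) * p / (real CARD('n) - p))"
      using u by (simp add: Dspace_def sobolev_conj_def)
    fix F :: "'n lattice set" assume F: "finite F"
    have "(\<Sum>x\<in>F. \<Sum>i\<in>UNIV. \<bar>u (x + axis i 1) - u x\<bar> powr p)
        \<le> (\<Sum>x\<in>F. \<Sum>y | adj x y. \<bar>grad x y u\<bar> powr p)"
      unfolding grad_def by (intro sum_mono sum_axis_le_sum_adj) auto
    also have "\<dots> \<le> energy p u"
      using fin F by (rule sum_le_energy)
    finally show "(\<Sum>x\<in>F. \<Sum>i\<in>UNIV. \<bar>u (x + axis i 1) - u x\<bar> powr p) \<le> energy p u" .
  qed (use p in \<open>auto simp: N_def\<close>)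
  also have "energy p u powr (1 / p) = 2 powr (1 / p) * Dnorm p u"
    using energy_nonneg[of p u] by (simp add: Dnorm_eq_energy powr_mult[symmetric])
  finally show ?thesis
    by (simp add: mult.assoc)
qed

lemma S_const_pos:
  assumes p: "1 < p" "p < real CARD('n)"
  shows "0 < S_const TYPE('n::finite) p"
proof -
  define c where "c = 2 * (p * (real CARD('n) - 1) / (real CARD('n) - p)) * 2 powr (1 / p)"
  have c0: "c > 0" using p by (simp add: c_def)
  have q0: "sobolev_conj TYPE('n) p > 0" using p by (simp add: sobolev_conj_def)
  have "ereal (1 / c powr p) \<le> S_const TYPE('n) p"
    unfolding S_const_def
  proof (rule INF_greatest)
    fix u :: "'n lattice \<Rightarrow> real" assume u: "u \<in> Dspace p - {\<lambda>x. 0}"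
    then have "0 < (\<Sum>\<^sub>\<infinity>x. \<bar>u x\<bar> powr sobolev_conj TYPE('n) p)"
      by (intro lspace_infsum_pos) (auto simp: Dspace_def)
    then have l: "0 < lnorm (sobolev_conj TYPE('n) p) u"
      by (simp add: lnorm_def)
    have "lnorm (sobolev_conj TYPE('n) p) u powr p \<le> (c * Dnorm p u) powr p"
      using sobolev_Dspace[of p u] p u l by (intro powr_mono2) (auto simp: c_def)
    also have "\<dots> = c powr p * Dnorm p u powr p"
      using c0 by (simp add: powr_mult Dnorm_def)
    finally show "ereal (1 / c powr p)
        \<le> ereal (Dnorm p u powr p / lnorm (sobolev_conj TYPE('n) p) u powr p)"
      using l c0 by (simp add: field_simps)
  qed
  moreover have "0 < ereal (1 / c powr p)" using c0 by simp
  ultimately show ?thesis by (rule less_le_trans[rotated])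
qed

section \<open>Comparison of the exponents 2 and p\<close>

text \<open>The inclusion of ell^2 in ell^p: each squared difference is at most the total energy
  \<open>A\<close>, so \<open>p / 2 - 1\<close> of the \<open>p / 2\<close> powers of the square can
  be replaced by powers of \<open>A\<close>.\<close>

lemma energy_le_energy_2:
  assumes p: "2 \<le> p" and fin: "Dnorm_finite 2 u"
  shows "Dnorm_finite p u" "energy p u \<le> energy 2 u powr (p / 2)"
proof -
  define A where "A = energy 2 u"
  have A0: "0 \<le> A" by (simp add: A_def energy_nonneg)
  have gA: "\<bar>grad x y u\<bar> powr 2 \<le> A" if "adj x y" for x y
  proof -
    have "\<bar>grad x y u\<bar> powr 2 \<le> (\<Sum>y | adj x y. \<bar>grad x y u\<bar> powr 2)"
      using that by (intro member_le_sum finite_adj) auto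
    also have "\<dots> \<le> A"
      using sum_le_energy[OF fin, of "{x}"] by (simp add: A_def)
    finally show ?thesis .
  qed
  have le: "(\<Sum>y | adj x y. \<bar>grad x y u\<bar> powr p)
      \<le> A powr (p / 2 - 1) * (\<Sum>y | adj x y. \<bar>grad x y u\<bar> powr 2)" for x
    unfolding sum_distrib_left
  proof (rule sum_mono)
    fix y assume "y \<in> {y. adj x y}"
    then have "(\<bar>grad x y u\<bar> powr 2) powr (p / 2 - 1) * \<bar>grad x y u\<bar> powr 2
        \<le> A powr (p / 2 - 1) * \<bar>grad x y u\<bar> powr 2"
      using p gA by (intro mult_right_mono powr_mono2) auto
    moreover have "(\<bar>grad x y u\<bar> powr 2) powr (p / 2 - 1) * \<bar>grad x y u\<bar> powr 2 = \<bar>grad x y u\<bar> powr p"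
      by (simp add: powr_powr powr_add[symmetric] del: powr_numeral)
    ultimately show "\<bar>grad x y u\<bar> powr p \<le> A powr (p / 2 - 1) * \<bar>grad x y u\<bar> powr 2"
      by simp
  qed
  have sum2: "(\<lambda>x. \<Sum>y | adj x y. \<bar>grad x y u\<bar> powr 2) summable_on UNIV"
    using fin by (simp add: Dnorm_finite_def)
  show finp: "Dnorm_finite p u"
    unfolding Dnorm_finite_def
    by (rule summable_on_comparison_test[OF summable_on_cmult_right[OF sum2] le]) (simp add: sum_nonneg)
  have "energy p u \<le> A powr (p / 2 - 1) * A"
    unfolding energy_def[of p] A_def energy_def[of 2] infsum_cmult_right[OF sum2, symmetric]
    using finp sum2 le
    by (intro infsum_mono summable_on_cmult_right) (auto simp: Dnorm_finite_def A_def energy_def)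
  also have "\<dots> = A powr (p / 2)"
    using A0 by (cases "A = 0") (auto simp: powr_diff)
  finally show "energy p u \<le> energy 2 u powr (p / 2)"
    by (simp add: A_def)
qed

text \<open>The factor 1/2 is dropped on the left and restored on the right, whence the constant
  \<open>sqrt 2\<close>.\<close>

lemma Dnorm_le_Dnorm_2:
  assumes p: "2 \<le> p" and fin: "Dnorm_finite 2 u"
  shows "Dnorm p u \<le> sqrt 2 * Dnorm 2 u"
proof -
  have "Dnorm p u \<le> (energy 2 u powr (p / 2)) powr (1 / p)"
    unfolding Dnorm_eq_energy using p energy_le_energy_2[OF p fin] energy_nonneg[of p u]
    by (intro powr_mono2) auto
  also have "\<dots> = energy 2 u powr (1 / 2)"
    using p by (simp add: powr_powr)
  also have "\<dots> = sqrt 2 * Dnorm 2 u"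
    using energy_nonneg[of 2 u]
    by (simp add: Dnorm_eq_energy powr_half_sqrt real_sqrt_mult[symmetric])
  finally show ?thesis .
qed

text \<open>The same approximants serve for both exponents. In the application the summability
  hypothesis is membership in \<open>lspace \<alpha>\<close>.\<close>

lemma Dspace_2_subset:
  fixes u :: "'n::finite lattice \<Rightarrow> real"
  assumes p: "2 \<le> p" and u: "u \<in> Dspace 2" "u \<in> lspace (sobolev_conj TYPE('n) p)"
  shows "u \<in> Dspace p"
proof -
  obtain \<phi> :: "nat \<Rightarrow> 'n lattice \<Rightarrow> real" where \<phi>: "\<And>k. finite {x. \<phi> k x \<noteq> 0}"
      "\<And>k. Dnorm_finite 2 (\<lambda>x. u x - \<phi> k x)" "(\<lambda>k. Dnorm 2 (\<lambda>x. u x - \<phi> k x)) \<longlonglongrightarrow> 0"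
    using u(1) by (auto simp: Dspace_def)
  have "(\<lambda>k. Dnorm p (\<lambda>x. u x - \<phi> k x)) \<longlonglongrightarrow> 0"
  proof (rule tendsto_sandwich)
    show "\<forall>\<^sub>F k in sequentially. 0 \<le> Dnorm p (\<lambda>x. u x - \<phi> k x)"
      by (simp add: Dnorm_def)
    show "\<forall>\<^sub>F k in sequentially. Dnorm p (\<lambda>x. u x - \<phi> k x) \<le> sqrt 2 * Dnorm 2 (\<lambda>x. u x - \<phi> k x)"
      using p \<phi>(2) by (intro always_eventually allI Dnorm_le_Dnorm_2)
    show "(\<lambda>k. sqrt 2 * Dnorm 2 (\<lambda>x. u x - \<phi> k x)) \<longlonglongrightarrow> 0"
      using tendsto_mult[OF tendsto_const \<phi>(3), of "sqrt 2"] by simp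
  qed simp
  then show ?thesis
    using \<phi> p u(2) energy_le_energy_2(1) unfolding Dspace_def by blast
qed

section \<open>The Born-Infeld energy\<close>

text \<open>Both bounds compare \<open>1 - s\<close> with a square,
  \<open>(1 - s / 2)\<^sup>2\<close> from above and \<open>(1 - s)\<^sup>2\<close> from below. The
  first keeps \<open>kappa\<close> away from 0, the second makes \<open>J\<close> finite on
  \<open>Xset\<close>.\<close>

lemma one_minus_sqrt_bounds:
  fixes s :: real
  assumes "0 \<le> s" "s \<le> 1"
  shows "s / 2 \<le> 1 - sqrt (1 - s)" "1 - sqrt (1 - s) \<le> s"
proof -
  have "sqrt (1 - s) \<le> sqrt ((1 - s / 2)\<^sup>2)"
    by (intro real_sqrt_le_mono) (simp add: power2_eq_square algebra_simps)
  then show "s / 2 \<le> 1 - sqrt (1 - s)"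
    using assms by simp
  have "sqrt ((1 - s)\<^sup>2) \<le> sqrt (1 - s)"
    using assms by (intro real_sqrt_le_mono) (simp add: power2_eq_square mult_left_le)
  then show "1 - sqrt (1 - s) \<le> s"
    using assms by simp
qed

lemma kappa_real:
  assumes "2 \<le> p"
  obtains k where "kappa p = ereal k" "1/2 \<le> k"
    "\<And>s. 0 \<le> s \<Longrightarrow> s \<le> 1 \<Longrightarrow> k * s powr (p / 2) \<le> 1 - sqrt (1 - s)"
proof -
  have lower: "ereal (1/2) \<le> kappa p"
    unfolding kappa_def
  proof (rule INF_greatest)
    fix s :: real assume s: "s \<in> {0<..1}"
    \<comment> \<open>On (0,1] a larger exponent gives a smaller power, so the quotient is at least
      \<open>(1 - sqrt (1 - s)) / s\<close>.\<close>
    have "s powr (p / 2) \<le> s powr 1"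
      using s assms by (intro powr_mono') auto
    then show "ereal (1/2) \<le> ereal ((1 - sqrt (1 - s)) / s powr (p / 2))"
      using one_minus_sqrt_bounds(1)[of s] s by (simp add: field_simps)
  qed
  have upper: "kappa p \<le> ereal ((1 - sqrt (1 - s)) / s powr (p / 2))" if "0 < s" "s \<le> 1" for s
    unfolding kappa_def using that by (intro INF_lower) auto
  obtain k where k: "kappa p = ereal k"
    using lower upper[of 1] by (cases "kappa p") auto
  show ?thesis
  proof
    show "kappa p = ereal k" by (rule k)
    show "1/2 \<le> k" using lower k by simp
    \<comment> \<open>The value \<open>s = 0\<close> lies outside the range of the infimum; there
      both sides are 0.\<close>
    show "k * s powr (p / 2) \<le> 1 - sqrt (1 - s)" if "0 \<le> s" "s \<le> 1" for s
      using upper[of s] that k by (cases "s = 0") (auto simp: field_simps)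
  qed
qed

lemma Xset_J_summable:
  assumes "u \<in> Xset"
  shows "(\<lambda>x. \<Sum>y | adj x y. 1 - sqrt (1 - \<bar>grad x y u\<bar>\<^sup>2)) summable_on UNIV"
    and "J u \<le> 1/2 * energy 2 u"
proof -
  have sum2: "(\<lambda>x. \<Sum>y | adj x y. \<bar>grad x y u\<bar> powr 2) summable_on UNIV"
    using assms Dspace_Dnorm_finite[of 2 u] by (simp add: Xset_def Dnorm_finite_def)
  have g1: "\<bar>grad x y u\<bar>\<^sup>2 \<le> 1" if "adj x y" for x y
    using assms that by (simp add: Xset_def abs_le_square_iff[of _ 1, simplified])
  have le: "(\<Sum>y | adj x y. 1 - sqrt (1 - \<bar>grad x y u\<bar>\<^sup>2)) \<le> (\<Sum>y | adj x y. \<bar>grad x y u\<bar> powr 2)" for x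
    using one_minus_sqrt_bounds(2) g1 by (intro sum_mono) auto
  show summ: "(\<lambda>x. \<Sum>y | adj x y. 1 - sqrt (1 - \<bar>grad x y u\<bar>\<^sup>2)) summable_on UNIV"
    by (rule summable_on_comparison_test[OF sum2 le]) (auto intro: sum_nonneg)
  show "J u \<le> 1/2 * energy 2 u"
    unfolding J_def energy_def by (intro mult_left_mono infsum_mono summ sum2 le) simp
qed

text \<open>The hypothesis \<open>ks\<close> is applied on each edge with \<open>s\<close> the
  squared difference, so that \<open>s powr (p / 2)\<close> is its \<open>p\<close>-th
  power.\<close>

lemma J_ge_Dnorm:
  assumes u: "u \<in> Xset" and p: "2 \<le> p" and k: "0 \<le> k"
    and ks: "\<And>s. 0 \<le> s \<Longrightarrow> s \<le> 1 \<Longrightarrow> k * s powr (p / 2) \<le> 1 - sqrt (1 - s)"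
  shows "k * Dnorm p u powr p \<le> J u"
proof -
  have "Dnorm_finite 2 u"
    using u Dspace_Dnorm_finite[of 2 u] by (simp add: Xset_def)
  then have sump: "(\<lambda>x. \<Sum>y | adj x y. \<bar>grad x y u\<bar> powr p) summable_on UNIV"
    using energy_le_energy_2(1)[OF p] by (simp add: Dnorm_finite_def)
  have le: "k * (\<Sum>y | adj x y. \<bar>grad x y u\<bar> powr p) \<le> (\<Sum>y | adj x y. 1 - sqrt (1 - \<bar>grad x y u\<bar>\<^sup>2))" for x
    unfolding sum_distrib_left
  proof (rule sum_mono)
    fix y assume "y \<in> {y. adj x y}"
    then have "\<bar>grad x y u\<bar>\<^sup>2 \<le> 1"
      using u by (simp add: Xset_def abs_le_square_iff[of _ 1, simplified])
    then have "k * (\<bar>grad x y u\<bar>\<^sup>2) powr (p / 2) \<le> 1 - sqrt (1 - \<bar>grad x y u\<bar>\<^sup>2)"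
      by (intro ks) auto
    moreover have "(\<bar>grad x y u\<bar>\<^sup>2) powr (p / 2) = (\<bar>grad x y u\<bar> powr 2) powr (p / 2)"
      by simp
    ultimately show "k * \<bar>grad x y u\<bar> powr p \<le> 1 - sqrt (1 - \<bar>grad x y u\<bar>\<^sup>2)"
      by (simp add: powr_powr del: powr_numeral)
  qed
  have "k * energy p u \<le> (\<Sum>\<^sub>\<infinity>x. \<Sum>y | adj x y. 1 - sqrt (1 - \<bar>grad x y u\<bar>\<^sup>2))"
    unfolding energy_def infsum_cmult_right[OF sump, symmetric]
    by (intro infsum_mono summable_on_cmult_right sump Xset_J_summable u le)
  then show ?thesis
    using p by (simp add: Dnorm_powr J_def)
qed

section \<open>Multiples of a point mass as test functions\<close>

definition delta :: "real \<Rightarrow> 'n::finite lattice \<Rightarrow> real" where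
  "delta t x = (if x = 0 then t else 0)"

lemma delta_finite_support: "finite {x. delta t x \<noteq> 0}"
  by (rule finite_subset[of _ "{0}"]) (auto simp: delta_def)

lemma delta_Xset: "0 \<le> t \<Longrightarrow> t \<le> 1 \<Longrightarrow> delta t \<in> Xset"
  unfolding Xset_def
  by (intro CollectI conjI Dspace_finite_support delta_finite_support) (auto simp: delta_def grad_def)

lemma delta_lspace: "delta t \<in> lspace q"
proof -
  have "finite {x \<in> UNIV. \<bar>delta t x\<bar> powr q \<noteq> 0}"
    by (rule finite_subset[OF _ delta_finite_support[of t]]) auto
  from finite_nonzero_values_imp_summable_on[OF this] show ?thesis
    by (simp add: lspace_def)
qed

lemma infsum_delta:
  assumes "0 \<le> t"
  shows "(\<Sum>\<^sub>\<infinity>x::'n::finite lattice. \<bar>delta t x\<bar> powr q) = t powr q"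
proof -
  have "(\<Sum>\<^sub>\<infinity>x::'n lattice. \<bar>delta t x\<bar> powr q) = (\<Sum>\<^sub>\<infinity>x\<in>{0::'n lattice}. \<bar>delta t x\<bar> powr q)"
    by (intro infsum_cong_neutral) (auto simp: delta_def)
  then show ?thesis
    using assms by (simp add: delta_def)
qed

text \<open>Homogeneity of degree 2. The energy of the unit mass is left unevaluated, since only the
  power of \<open>t\<close> matters.\<close>

lemma energy_delta:
  assumes "0 \<le> t"
  shows "energy 2 (delta t :: 'n::finite lattice \<Rightarrow> real) = t\<^sup>2 * energy 2 (delta 1 :: 'n lattice \<Rightarrow> real)"
proof -
  have "(\<Sum>y | adj x y. \<bar>grad x y (delta t)\<bar> powr 2)
      = t\<^sup>2 * (\<Sum>y | adj x y. \<bar>grad x y (delta 1)\<bar> powr 2)" for x :: "'n lattice"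
    unfolding sum_distrib_left by (intro sum.cong) (auto simp: grad_def delta_def)
  then show ?thesis
    by (simp add: energy_def infsum_cmult_right')
qed

text \<open>At \<open>delta t\<close> the numerator is at most of order \<open>t\<^sup>2\<close> and
  the denominator is \<open>t\<close> to the power \<open>N * \<alpha> / (N + \<alpha>)\<close>. The
  choice \<open>t = 1\<close> yields finiteness of the infimum, and \<open>t\<close> tending to 0
  settles the subcritical case.\<close>

lemma C_const_le_delta:
  assumes "0 < t" "t \<le> 1"
  shows "C_const TYPE('n::finite) \<alpha> \<le> ereal (1/2 * energy 2 (delta 1 :: 'n lattice \<Rightarrow> real)
    * t powr (2 - real CARD('n) * \<alpha> / (real CARD('n) + \<alpha>)))"
proof -
  let ?d = "delta t :: 'n lattice \<Rightarrow> real"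
  let ?r = "real CARD('n) * \<alpha> / (real CARD('n) + \<alpha>)"
  have "?d \<in> (Xset \<inter> lspace \<alpha>) - {\<lambda>x. 0}"
    using assms delta_Xset[of t] delta_lspace[of t \<alpha>] by (auto simp: delta_def fun_eq_iff)
  then have "C_const TYPE('n) \<alpha>
      \<le> ereal (J ?d / (\<Sum>\<^sub>\<infinity>x. \<bar>?d x\<bar> powr \<alpha>) powr (real CARD('n) / (real CARD('n) + \<alpha>)))"
    unfolding C_const_def by (rule INF_lower)
  also have "(\<Sum>\<^sub>\<infinity>x. \<bar>?d x\<bar> powr \<alpha>) powr (real CARD('n) / (real CARD('n) + \<alpha>)) = t powr ?r"
    using assms by (simp add: infsum_delta powr_powr mult.commute)
  also have "ereal (J ?d / t powr ?r) \<le> ereal (1/2 * energy 2 ?d / t powr ?r)"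
    unfolding ereal_less_eq using assms
    by (intro divide_right_mono Xset_J_summable(2) delta_Xset) auto
  also have "1/2 * energy 2 ?d / t powr ?r = 1/2 * energy 2 (delta 1 :: 'n lattice \<Rightarrow> real) * t powr (2 - ?r)"
    using assms by (simp add: energy_delta[of t] powr_diff)
  finally show ?thesis .
qed

theorem theorem1p1:
  fixes N \<alpha> p\<^sub>\<alpha> :: real
  assumes "N = real CARD('n::finite)"
    and "N \<ge> 3"
    and "\<alpha> > 2"
    and "p\<^sub>\<alpha> = N * \<alpha> / (N + \<alpha>)"
  shows "(C_const TYPE('n) \<alpha> > 0 \<longleftrightarrow> \<alpha> \<ge> 2 * N / (N - 2)) \<and>
    (\<alpha> \<ge> 2 * N / (N - 2) \<longrightarrow>
      2 \<le> p\<^sub>\<alpha> \<and> p\<^sub>\<alpha> < N \<and>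
      0 < kappa p\<^sub>\<alpha> * S_const TYPE('n) p\<^sub>\<alpha> \<and>
      kappa p\<^sub>\<alpha> * S_const TYPE('n) p\<^sub>\<alpha> \<le> C_const TYPE('n) \<alpha> \<and>
      C_const TYPE('n) \<alpha> < \<infinity>)"
proof -
  let ?p = "p\<^sub>\<alpha>"
  \<comment> \<open>With denominators cleared, both sides say
    \<open>\<alpha> * (N - 2) \<ge> 2 * N\<close>; here \<open>N > 2\<close> enters.\<close>
  have p_ge_2: "2 \<le> ?p \<longleftrightarrow> \<alpha> \<ge> 2 * N / (N - 2)"
    unfolding assms(4) using assms(2,3) by (simp add: field_simps)
  have p_less: "?p < N"
    unfolding assms(4) using assms(2,3) by (simp add: field_simps)
  have conj: "sobolev_conj TYPE('n) ?p = \<alpha>"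
  proof -
    have "N - ?p = N\<^sup>2 / (N + \<alpha>)"
      using assms by (simp add: field_simps power2_eq_square)
    then have "N * ?p / (N - ?p) = \<alpha>"
      using assms by (simp add: power2_eq_square)
    then show ?thesis
      using assms(1) by (simp add: sobolev_conj_def)
  qed
  \<comment> \<open>Hence the denominator in \<open>C_const\<close> is the \<open>?p\<close>-th
    power of the ell^\<alpha> norm, the same as in \<open>S_const\<close>.\<close>
  have p\<alpha>: "?p / \<alpha> = N / (N + \<alpha>)"
    using assms by simp
  have "C_const TYPE('n) \<alpha> \<le> ereal (1/2 * energy 2 (delta 1 :: 'n lattice \<Rightarrow> real)
      * 1 powr (2 - real CARD('n) * \<alpha> / (real CARD('n) + \<alpha>)))"
    by (rule C_const_le_delta) auto
  then have finite_C: "C_const TYPE('n) \<alpha> < \<infinity>"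
    by (rule le_less_trans) simp
  \<comment> \<open>The exponent \<open>2 - ?p\<close> is positive here, so the bound from
    \<open>delta t\<close> tends to 0 with \<open>t\<close>.\<close>
  have zero_C: "C_const TYPE('n) \<alpha> \<le> 0" if "?p < 2"
  proof -
    let ?c = "1/2 * energy 2 (delta 1 :: 'n lattice \<Rightarrow> real)"
    have "((\<lambda>t::real. t powr (2 - ?p)) \<longlongrightarrow> 0 powr (2 - ?p)) (at_right 0)"
      using that by (intro tendsto_powr' tendsto_ident_at tendsto_const)
        (auto simp: eventually_at_right_field intro!: exI[of _ 1])
    from tendsto_mult[OF tendsto_const this, of ?c]
    have lim: "((\<lambda>t. ereal (?c * t powr (2 - ?p))) \<longlongrightarrow> ereal 0) (at_right 0)"
      using that by simp
    have "C_const TYPE('n) \<alpha> \<le> ereal 0"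
    proof (rule tendsto_lowerbound[OF lim])
      show "\<forall>\<^sub>F t in at_right 0. C_const TYPE('n) \<alpha> \<le> ereal (?c * t powr (2 - ?p))"
        using C_const_le_delta[where 'n = 'n, of _ \<alpha>] assms(1,4)
        by (auto simp: eventually_at_right_field intro!: exI[of _ 1])
    qed simp
    then show ?thesis by (simp add: zero_ereal_def)
  qed
  have bound: "0 < kappa ?p * S_const TYPE('n) ?p \<and> kappa ?p * S_const TYPE('n) ?p \<le> C_const TYPE('n) \<alpha>"
    if p2: "2 \<le> ?p"
  proof -
    obtain k where k: "kappa ?p = ereal k" "1/2 \<le> k"
      and ks: "\<And>s. 0 \<le> s \<Longrightarrow> s \<le> 1 \<Longrightarrow> k * s powr (?p / 2) \<le> 1 - sqrt (1 - s)"
      using kappa_real[OF p2] by blast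
    have "0 < S_const TYPE('n) ?p"
      using p2 p_less assms(1) by (intro S_const_pos) auto
    then have "0 < kappa ?p * S_const TYPE('n) ?p"
      using k by (simp add: ereal_zero_less_0_iff)
    moreover have "kappa ?p * S_const TYPE('n) ?p \<le> C_const TYPE('n) \<alpha>"
      unfolding C_const_def
    proof (rule INF_greatest)
      fix u :: "'n lattice \<Rightarrow> real" assume u: "u \<in> (Xset \<inter> lspace \<alpha>) - {\<lambda>x. 0}"
      define I where "I = (\<Sum>\<^sub>\<infinity>x. \<bar>u x\<bar> powr \<alpha>)"
      have lnorm: "lnorm \<alpha> u powr ?p = I powr (N / (N + \<alpha>))"
        by (simp add: lnorm_def I_def powr_powr p\<alpha>)
      have "u \<in> Dspace ?p"
        using u conj Dspace_2_subset[OF p2, of u] by (simp add: Xset_def)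
      then have "S_const TYPE('n) ?p \<le> ereal (Dnorm ?p u powr ?p / lnorm \<alpha> u powr ?p)"
        unfolding S_const_def conj using u by (intro INF_lower) auto
      \<comment> \<open>Multiplication is monotone in \<open>ereal\<close> because \<open>k\<close>
        is nonnegative; from here on all quantities on the right are real.\<close>
      then have "kappa ?p * S_const TYPE('n) ?p
          \<le> ereal k * ereal (Dnorm ?p u powr ?p / lnorm \<alpha> u powr ?p)"
        unfolding k(1) using k(2) by (intro ereal_mult_left_mono) auto
      also have "\<dots> = ereal (k * Dnorm ?p u powr ?p / I powr (N / (N + \<alpha>)))"
        by (simp add: lnorm)
      also have "\<dots> \<le> ereal (J u / I powr (N / (N + \<alpha>)))"
        unfolding ereal_less_eq using u k(2)
        by (intro divide_right_mono J_ge_Dnorm[OF _ p2 _ ks]) auto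
      finally show "kappa ?p * S_const TYPE('n) ?p
          \<le> ereal (J u / (\<Sum>\<^sub>\<infinity>x. \<bar>u x\<bar> powr \<alpha>) powr (real CARD('n) / (real CARD('n) + \<alpha>)))"
        using assms(1) by (simp add: I_def)
    qed
    ultimately show ?thesis by blast
  qed
  show ?thesis
  proof (cases "2 \<le> ?p")
    case True
    have "0 < C_const TYPE('n) \<alpha>"
      using bound[OF True] less_le_trans by blast
    then show ?thesis
      using True p_ge_2 p_less finite_C bound[OF True] by simp
  next
    case False
    then have "\<not> 0 < C_const TYPE('n) \<alpha>"
      using zero_C by (simp add: not_less)
    then show ?thesis
      using False p_ge_2 by simp
  qed
qed

end
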